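(* Let $S$ be a (divisible) measuring semiring with quotient $d:S\to D=S/{\sim}$, and let $P=\mathbb{R}\langle Z^D\rangle$ be the associated monomial semiring with quotient map $d_P:P\to D$. Then there is a semiring homomorphism $\phi:S\to P$ such that $d=d_P\circ\phi$, with the property that for $x,y\in S$, $x\approx y$ if and only if $\phi(x)=\phi(y)$.
   Context: An ordered semiring $S=(S,+,\cdot,0,1,<)$ satisfies: $(S,+,0)$ and $(S,\cdot,1)$ are commutative monoids; $\cdot$ distributes over $+$; $<$ is a total order with least element $0$; $x\le y\Rightarrow x+z\le y+z$; $x\le y\Rightarrow xz\le yz$; $0\cdot x=x\cdot 0=0$; $0<x,\ 0<y\Rightarrow 0<xy$; $0\ne1$. Write $a\sim b$ if $a\le b\le n\cdot a$ or $b\le a\le n\cdot b$ for some positive integer $n$ (with $n\cdot a=a+\dots+a$); $\sim$ is an equivalence relation with convex classes. $d:S\to D:=S/{\sim}$ is the quotient map; $D$ is totally ordered with least element $-\infty=d(0)$. $S$ is a measuring semiring if in addition for all $x,y,z\in S$: if $x<y$ and $d(y)=d(z)$ then $x+z<y+z$. The multiplication of $S$ induces a well-defined operation $\oplus$ on $D$, $d(x)\oplus d(y)=d(xy)$, with identity $0_D=d(1)$. Divisibility: for every $s\in S$ and every positive rational $q=m/n$ there is a (unique) element $qs\in S$ with $n(qs)=ms$. For $x,y\in S$ write $x\approx y$ if $x\sim y$ and for all rationals $q>1$ we have $x\le qy$ and $y\le qx$. The monomial semiring: $P=\mathbb{R}\langle Z^D\rangle$ consists of a zero element $0$ (written $0Z^0$)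 and formal monomials $rZ^e$ with $r\in\mathbb{R}^{>0}$ and $e\in D\setminus\{-\infty\}$. Addition: $r_1Z^{e_1}\boxplus r_2Z^{e_2}$ equals $(r_1+r_2)Z^{e_1}$ if $e_1=e_2$, equals $r_1Z^{e_1}$ if $e_1>e_2$, and equals $r_2Z^{e_2}$ if $e_1<e_2$; $0$ is the additive identity. Multiplication: $r_1Z^{e_1}\boxdot r_2Z^{e_2}=r_1r_2Z^{e_1\oplus e_2}$, with $0$ absorbing and identity $1\cdot Z^{0_D}$. Order: $r_1Z^{e_1}<r_2Z^{e_2}$ iff $e_1<e_2$, or $e_1=e_2$ and $r_1<r_2$; $0$ is least. The map $d_P$ is given by $d_P(rZ^e)=e$ and $d_P(0)=-\infty$. *)

theory Defs
  imports Complex_Main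
begin

section \<open>Ordered semirings and archimedean equivalence\<close>

text \<open>
  Since \<open>0\<close> is the least element, the library axiom
  \<open>a \<le> b \<Longrightarrow> 0 \<le> c \<Longrightarrow> c * a \<le> c * b\<close> of \<^class>\<open>ordered_comm_semiring\<close> is unconditional
  monotonicity of multiplication.  The class \<^class>\<open>comm_semiring_1\<close> contains the laws
  \<open>0 * x = 0\<close> and \<open>0 \<noteq> 1\<close>.
\<close>

class zero_least_semiring = comm_semiring_1 + ordered_comm_semiring + linorder +
  assumes zero_least: "0 \<le> x"
    and pos_mult_pos: "0 < x \<Longrightarrow> 0 < y \<Longrightarrow> 0 < x * y"
begin

definition nmult :: "nat \<Rightarrow> 'a \<Rightarrow> 'a"
  where "nmult n a = (\<Sum>i<n. a)"

definition arch_equiv :: "'a \<Rightarrow> 'a \<Rightarrow> bool"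
  where "arch_equiv a b \<longleftrightarrow>
    (\<exists>n>0. (a \<le> b \<and> b \<le> nmult n a) \<or> (b \<le> a \<and> a \<le> nmult n b))"

lemma nmult_0 [simp]: "nmult 0 a = 0"
  and nmult_Suc: "nmult (Suc n) a = nmult n a + a"
  by (simp_all add: nmult_def add.commute del: sum_constant)

lemma nmult_1 [simp]: "nmult (Suc 0) a = a"
  by (simp add: nmult_Suc)

lemma nmult_of_nat: "nmult n a = of_nat n * a"
  by (simp add: nmult_def)

lemma nmult_nmult: "nmult m (nmult n a) = nmult (m * n) a"
  by (simp add: nmult_of_nat mult.assoc)

lemma nmult_mult: "nmult n a * b = nmult n (a * b)"
  by (simp add: nmult_of_nat mult.assoc)

lemma nmult_mono: "a \<le> b \<Longrightarrow> nmult n a \<le> nmult n b"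
  by (induction n) (auto simp: nmult_Suc intro: add_mono)

lemma le_add_right: "a \<le> a + b"
  using add_left_mono[OF zero_least[of b], of a] by simp

lemma nmult_mono_left: "m \<le> n \<Longrightarrow> nmult m a \<le> nmult n a"
  by (induction n rule: dec_induct) (auto simp: nmult_Suc intro: order_trans le_add_right)

lemma mult_mono_right: "a \<le> b \<Longrightarrow> a * c \<le> b * c"
  using mult_left_mono[OF _ zero_least] by (simp add: mult.commute)

lemma arch_equiv_iff:
  "arch_equiv a b \<longleftrightarrow> (\<exists>n. a \<le> nmult n b) \<and> (\<exists>n. b \<le> nmult n a)"
proof
  assume "arch_equiv a b"
  then show "(\<exists>n. a \<le> nmult n b) \<and> (\<exists>n. b \<le> nmult n a)"
    unfolding arch_equiv_def by (metis nmult_1)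
next
  assume "(\<exists>n. a \<le> nmult n b) \<and> (\<exists>n. b \<le> nmult n a)"
  then obtain m n where mn: "a \<le> nmult m b" "b \<le> nmult n a" by blast
  have "a \<le> nmult (Suc m) b" "b \<le> nmult (Suc n) a"
    using mn nmult_mono_left[of m "Suc m" b] nmult_mono_left[of n "Suc n" a]
    by (auto intro: order_trans)
  then show "arch_equiv a b"
    unfolding arch_equiv_def using linear[of a b] by blast
qed

lemma nmult_le_trans:
  assumes "a \<le> nmult m b" "b \<le> nmult n c"
  shows "a \<le> nmult (m * n) c"
  using assms nmult_mono[of b "nmult n c" m] by (auto simp: nmult_nmult intro: order_trans)

lemma arch_equiv_refl: "arch_equiv a a"
  unfolding arch_equiv_iff by (metis nmult_1 order_refl)

lemma arch_equiv_sym: "arch_equiv a b \<Longrightarrow> arch_equiv b a"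
  unfolding arch_equiv_iff by blast

lemma arch_equiv_trans: "arch_equiv a b \<Longrightarrow> arch_equiv b c \<Longrightarrow> arch_equiv a c"
  unfolding arch_equiv_iff by (meson nmult_le_trans)

lemma arch_equiv_mult:
  assumes "arch_equiv a a'" "arch_equiv b b'"
  shows "arch_equiv (a * b) (a' * b')"
proof -
  have *: "arch_equiv (a * b) (a' * b)" if "arch_equiv a a'" for a a' b
    using that unfolding arch_equiv_iff by (metis mult_mono_right nmult_mult)
  show ?thesis
    using *[OF assms(1), of b] *[OF assms(2), of a'] by (metis arch_equiv_trans mult.commute)
qed

lemma arch_equiv_0_iff: "arch_equiv 0 a \<longleftrightarrow> a = 0"
proof -
  have "nmult n 0 = 0" for n by (simp add: nmult_def)
  then show ?thesis
    unfolding arch_equiv_iff using zero_least[of a] by (auto intro: antisym)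
qed

text \<open>The order that \<open>\<le>\<close> induces on the (convex) equivalence classes.\<close>

definition arch_le :: "'a \<Rightarrow> 'a \<Rightarrow> bool"
  where "arch_le a b \<longleftrightarrow> a \<le> b \<or> arch_equiv a b"

lemma arch_le_iff: "arch_le a b \<longleftrightarrow> (\<exists>n. a \<le> nmult n b)"
proof
  show "arch_le a b \<Longrightarrow> \<exists>n. a \<le> nmult n b"
    unfolding arch_le_def arch_equiv_iff by (metis nmult_1)
next
  assume "\<exists>n. a \<le> nmult n b"
  moreover have "b \<le> a \<Longrightarrow> b \<le> nmult (Suc 0) a" by simp
  ultimately show "arch_le a b"
    unfolding arch_le_def arch_equiv_iff using linear[of a b] by blast
qed

lemma arch_le_cong:
  assumes "arch_equiv a a'" "arch_equiv b b'"
  shows "arch_le a b \<longleftrightarrow> arch_le a' b'"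
  using assms unfolding arch_le_iff arch_equiv_iff by (meson nmult_le_trans)

end

section \<open>The quotient by archimedean equivalence\<close>

quotient_type (overloaded) 'a magnitude = "'a::zero_least_semiring" / arch_equiv
  morphisms rep_magnitude magn
  by (rule equivpI; (rule reflpI sympI transpI); (rule arch_equiv_refl | blast intro: arch_equiv_sym arch_equiv_trans))

lemma magn_eq_iff: "magn x = magn y \<longleftrightarrow> arch_equiv x y"
  by (rule magnitude.abs_eq_iff)

instantiation magnitude :: (zero_least_semiring) "{linorder, order_bot}"
begin

lift_definition bot_magnitude :: "'a magnitude" is 0 .

lift_definition less_eq_magnitude :: "'a magnitude \<Rightarrow> 'a magnitude \<Rightarrow> bool" is arch_le
  by (rule arch_le_cong)

definition less_magnitude :: "'a magnitude \<Rightarrow> 'a magnitude \<Rightarrow> bool"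
  where "less_magnitude a b \<longleftrightarrow> a \<le> b \<and> \<not> b \<le> a"

instance
proof
  fix a b c :: "'a magnitude"
  show "a < b \<longleftrightarrow> a \<le> b \<and> \<not> b \<le> a" by (rule less_magnitude_def)
  show "a \<le> a" by transfer (simp add: arch_le_def)
  show "a \<le> b \<Longrightarrow> b \<le> c \<Longrightarrow> a \<le> c" by transfer (meson arch_le_iff nmult_le_trans)
  show "a \<le> b \<Longrightarrow> b \<le> a \<Longrightarrow> a = b" by transfer (simp add: arch_le_iff arch_equiv_iff)
  show "a \<le> b \<or> b \<le> a" by transfer (meson arch_le_def linear)
  show "bot \<le> a" by transfer (simp add: arch_le_def zero_least)
qed

end

text \<open>The operation \<open>\<oplus>\<close> on classes is written \<open>+\<close>; its identity \<open>d(1)\<close> is \<open>0\<close>, whereas the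
  class of \<open>0\<close> is \<^const>\<open>bot\<close>.\<close>

instantiation magnitude :: (zero_least_semiring) comm_monoid_add
begin

lift_definition zero_magnitude :: "'a magnitude" is 1 .

lift_definition plus_magnitude :: "'a magnitude \<Rightarrow> 'a magnitude \<Rightarrow> 'a magnitude" is times
  by (rule arch_equiv_mult)

instance
  by standard (transfer, simp add: ac_simps arch_equiv_refl)+

end

section \<open>Measuring semirings\<close>

text \<open>The hypothesis \<open>arch_equiv y z\<close> is \<open>magn y = magn z\<close>, see \<open>magn_eq_iff\<close>.\<close>

class measuring_semiring = zero_least_semiring +
  assumes measuring: "x < y \<Longrightarrow> arch_equiv y z \<Longrightarrow> x + z < y + z"
begin

lemma arch_equiv_nmult: "0 < n \<Longrightarrow> arch_equiv a (nmult n a)"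
  unfolding arch_equiv_def using nmult_mono_left[of 1 n a] by auto

lemma nmult_less_Suc:
  assumes "0 < a"
  shows "nmult n a < nmult (Suc n) a"
  using assms measuring[OF assms arch_equiv_nmult[of n a]]
  by (cases n) (auto simp: nmult_Suc ac_simps)

lemma nmult_strict_mono:
  assumes "a < b" "0 < n"
  shows "nmult n a < nmult n b"
  using assms(2)
proof (induction n)
  case (Suc n)
  show ?case
  proof (cases "n = 0")
    case False
    have "nmult n a + a \<le> nmult n b + a"
      using nmult_mono[of a b n] assms(1) by (intro add_right_mono) auto
    also have "\<dots> < nmult n b + b"
      using measuring[OF assms(1) arch_equiv_nmult[of n b]] False by (simp add: add.commute)
    finally show ?thesis by (simp add: nmult_Suc)
  qed (use assms in simp)
qed simp

lemma nmult_inject: "0 < n \<Longrightarrow> nmult n a = nmult n b \<longleftrightarrow> a = b"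
  using nmult_strict_mono[of a b n] nmult_strict_mono[of b a n] by (metis less_irrefl neqE)

lemma arch_le_mult_cancel:
  assumes "x \<noteq> 0" "arch_le (x * z) (x * y)"
  shows "arch_le z y"
proof (rule ccontr)
  assume "\<not> arch_le z y"
  then have lt: "nmult n y < z" for n unfolding arch_le_iff by (meson not_le)
  have pos: "0 < x" "0 < z"
    using assms(1) lt[of 0] zero_least[of x] by (auto simp: less_le)
  then have xz: "0 < x * z" by (rule pos_mult_pos)
  obtain n where n: "x * z \<le> nmult n (x * y)" using assms(2) unfolding arch_le_iff by blast
  have xy: "0 < x * y"
  proof (rule ccontr)
    assume "\<not> 0 < x * y"
    then have "x * y = 0" using zero_least[of "x * y"] by (simp add: less_le)
    then show False using n xz by (simp add: nmult_of_nat leD)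
  qed
  have "nmult (Suc n) (x * y) = nmult (Suc n) y * x" by (metis nmult_mult mult.commute)
  also have "\<dots> \<le> z * x" using lt by (intro mult_mono_right less_imp_le)
  also have "\<dots> \<le> nmult n (x * y)" using n by (simp add: mult.commute)
  finally show False using nmult_less_Suc[OF xy, of n] by (simp add: leD)
qed

end

text \<open>
  Divisibility only asks for existence; uniqueness is a consequence in a measuring semiring
  (\<open>nmult_inject\<close>), so that \<open>qmult q s\<close> below is well defined for \<open>q > 0\<close>
  and independent of the representation of \<open>q\<close> as a fraction (\<open>qmult_iff\<close>).
\<close>

class divisible_measuring_semiring = measuring_semiring +
  assumes divisible: "0 < m \<Longrightarrow> 0 < n \<Longrightarrow> \<exists>t. nmult n t = nmult m s"
begin

definition qmult :: "rat \<Rightarrow> 'a \<Rightarrow> 'a"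
  where "qmult q s =
    (THE t. \<forall>m n. 0 < m \<longrightarrow> 0 < n \<longrightarrow> q = of_nat m / of_nat n \<longrightarrow> nmult n t = nmult m s)"

lemma qmult_iff:
  assumes "0 < m" "0 < n"
  shows "qmult (of_nat m / of_nat n) s = t \<longleftrightarrow> nmult n t = nmult m s"
proof -
  have *: "nmult n' t = nmult m' s"
    if "nmult n t = nmult m s" "0 < m'" "0 < n'"
       "of_nat m / of_nat n = (of_nat m' / of_nat n' :: rat)" for m' n' t
  proof -
    have "(of_nat (m * n') :: rat) = of_nat (m' * n)"
      using that assms by (simp add: field_simps)
    then have eq: "m * n' = m' * n" by (simp only: of_nat_eq_iff)
    have "nmult n (nmult n' t) = nmult n' (nmult n t)"
      by (simp only: nmult_nmult Groups.mult.commute[of n n'])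
    also have "\<dots> = nmult (m * n') s"
      by (simp only: that(1) nmult_nmult Groups.mult.commute[of n' m])
    also have "\<dots> = nmult n (nmult m' s)"
      by (simp only: eq nmult_nmult Groups.mult.commute[of m' n])
    finally show ?thesis by (simp only: nmult_inject[OF assms(2)])
  qed
  obtain t0 where t0: "nmult n t0 = nmult m s" using divisible[OF assms] by blast
  have "qmult (of_nat m / of_nat n) s = t0"
    unfolding qmult_def
  proof (rule the_equality)
    show "\<forall>m' n'. 0 < m' \<longrightarrow> 0 < n' \<longrightarrow>
        (of_nat m / of_nat n :: rat) = of_nat m' / of_nat n' \<longrightarrow> nmult n' t0 = nmult m' s"
      using *[OF t0] by blast
  next
    fix t'
    assume "\<forall>m' n'. 0 < m' \<longrightarrow> 0 < n' \<longrightarrow>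
        (of_nat m / of_nat n :: rat) = of_nat m' / of_nat n' \<longrightarrow> nmult n' t' = nmult m' s"
    then have "nmult n t' = nmult n t0" using assms t0 by simp
    then show "t' = t0" by (simp only: nmult_inject[OF assms(2)])
  qed
  then show ?thesis by (simp only: t0[symmetric] nmult_inject[OF assms(2)]) blast
qed

definition nearly_equal :: "'a \<Rightarrow> 'a \<Rightarrow> bool"
  where "nearly_equal x y \<longleftrightarrow>
    arch_equiv x y \<and> (\<forall>q>1. x \<le> qmult q y \<and> y \<le> qmult q x)"

end

section \<open>Monomial semirings\<close>

text \<open>
  The properties of the totally ordered monoid \<open>(D, \<oplus>, \<le>)\<close> that make the monomials with
  exponents in \<open>D\<close> a semiring.
\<close>

class exponent_monoid = linorder + order_bot + comm_monoid_add +
  assumes zero_neq_bot: "0 \<noteq> bot"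
    and add_bot: "a + bot = bot"
    and add_strict_mono: "a \<noteq> bot \<Longrightarrow> b < c \<Longrightarrow> a + b < a + c"
begin

lemma bot_add: "bot + a = bot"
  using add_bot[of a] by (simp add: add.commute)

lemma add_neq_bot: "a \<noteq> bot \<Longrightarrow> b \<noteq> bot \<Longrightarrow> a + b \<noteq> bot"
  using add_strict_mono[of a bot b] by (simp add: bot.not_eq_extremum add_bot)

lemma add_less_iff: "a \<noteq> bot \<Longrightarrow> a + b < a + c \<longleftrightarrow> b < c"
  using add_strict_mono[of a b c] add_strict_mono[of a c b] by (metis less_asym neqE)

lemma add_eq_iff: "a \<noteq> bot \<Longrightarrow> a + b = a + c \<longleftrightarrow> b = c"
  using add_strict_mono[of a b c] add_strict_mono[of a c b] by (metis less_irrefl neqE)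

end

instance magnitude :: (measuring_semiring) exponent_monoid
proof
  fix a b c :: "'a magnitude"
  show "0 \<noteq> (bot :: 'a magnitude)" by transfer (metis arch_equiv_0_iff arch_equiv_sym zero_neq_one)
  show "a + bot = bot" by transfer (simp add: arch_equiv_refl)
  show "a + b < a + c" if "a \<noteq> bot" "b < c"
    using that unfolding not_le[symmetric]
    by transfer (metis arch_equiv_refl arch_le_mult_cancel)
qed

text \<open>\<open>None\<close> is the zero element, \<open>Some (r, e)\<close> the monomial \<open>r Z\<^sup>e\<close>.\<close>

typedef (overloaded) 'd monomial =
  "{m :: (real \<times> 'd::exponent_monoid) option. \<forall>r e. m = Some (r, e) \<longrightarrow> 0 < r \<and> e \<noteq> bot}"
  by (rule exI[of _ None]) simp

setup_lifting type_definition_monomial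

lift_definition monomial_magn :: "'d::exponent_monoid monomial \<Rightarrow> 'd"
  is "\<lambda>m. case m of None \<Rightarrow> bot | Some (r, e) \<Rightarrow> e" .

instantiation monomial :: (exponent_monoid) "{zero, one, plus, times, ord}"
begin

lift_definition zero_monomial :: "'a monomial" is None by simp

lift_definition one_monomial :: "'a monomial" is "Some (1, 0)"
  by (simp add: zero_neq_bot)

lift_definition plus_monomial :: "'a monomial \<Rightarrow> 'a monomial \<Rightarrow> 'a monomial"
  is "\<lambda>x y. case (x, y) of
        (None, _) \<Rightarrow> y
      | (_, None) \<Rightarrow> x
      | (Some (r1, e1), Some (r2, e2)) \<Rightarrow>
          if e1 = e2 then Some (r1 + r2, e1)
          else if e1 > e2 then Some (r1, e1)
          else Some (r2, e2)"
  by (auto split: option.splits prod.splits if_splits)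

lift_definition times_monomial :: "'a monomial \<Rightarrow> 'a monomial \<Rightarrow> 'a monomial"
  is "\<lambda>x y. case (x, y) of
        (Some (r1, e1), Some (r2, e2)) \<Rightarrow> Some (r1 * r2, e1 + e2)
      | _ \<Rightarrow> None"
  by (auto split: option.splits prod.splits simp: add_neq_bot)

lift_definition less_monomial :: "'a monomial \<Rightarrow> 'a monomial \<Rightarrow> bool"
  is "\<lambda>x y. case (x, y) of
        (_, None) \<Rightarrow> False
      | (None, Some _) \<Rightarrow> True
      | (Some (r1, e1), Some (r2, e2)) \<Rightarrow> e1 < e2 \<or> e1 = e2 \<and> r1 < r2" .

definition less_eq_monomial :: "'a monomial \<Rightarrow> 'a monomial \<Rightarrow> bool"
  where "less_eq_monomial x y \<longleftrightarrow> x < y \<or> x = y"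

instance ..

end

instance monomial :: (exponent_monoid) zero_least_semiring
proof
  fix a b c :: "'a monomial"
  show "a + b + c = a + (b + c)"
    by transfer (auto split: option.splits prod.splits if_splits)
  show "a + b = b + a"
    by transfer (auto split: option.splits prod.splits if_splits)
  show "0 + a = a"
    by transfer (auto split: option.splits)
  show "a * b * c = a * (b * c)"
    by transfer (auto split: option.splits prod.splits simp: ac_simps)
  have comm: "a * b = b * a" for a b :: "'a monomial"
    by transfer (auto split: option.splits prod.splits simp: ac_simps)
  show "a * b = b * a"
    by (rule comm)
  show "1 * a = a"
    by transfer (auto split: option.splits prod.splits)
  show "0 * a = 0" "a * 0 = 0"
    by (transfer, auto split: option.splits)+
  show "(0 :: 'a monomial) \<noteq> 1"
    by transfer simp
  show "(a + b) * c = a * c + b * c"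
  proof -
    have "c * (a + b) = c * a + c * b"
      by transfer
        (simp split: option.split prod.split, auto simp: distrib_left add_less_iff add_eq_iff)
    then show ?thesis by (simp only: comm)
  qed
  show "a \<le> a"
    by (simp add: less_eq_monomial_def)
  show "a < b \<longleftrightarrow> a \<le> b \<and> \<not> b \<le> a"
    unfolding less_eq_monomial_def by transfer (auto split: option.splits prod.splits)
  show "a \<le> b \<Longrightarrow> b \<le> c \<Longrightarrow> a \<le> c"
    unfolding less_eq_monomial_def by transfer (auto split: option.splits prod.splits)
  show "a \<le> b \<Longrightarrow> b \<le> a \<Longrightarrow> a = b"
    unfolding less_eq_monomial_def by transfer (auto split: option.splits prod.splits)
  show "a \<le> b \<or> b \<le> a"
    unfolding less_eq_monomial_def by transfer (auto split: option.splits prod.splits)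
  show "0 \<le> a"
    unfolding less_eq_monomial_def by transfer (auto split: option.splits prod.splits)
  show "0 < a \<Longrightarrow> 0 < b \<Longrightarrow> 0 < a * b"
    by transfer (auto split: option.splits prod.splits)
  show "a \<le> b \<Longrightarrow> c + a \<le> c + b"
    unfolding less_eq_monomial_def
    by transfer (simp split: option.split prod.split, auto)
  show "a \<le> b \<Longrightarrow> 0 \<le> c \<Longrightarrow> c * a \<le> c * b"
    unfolding less_eq_monomial_def
    by transfer (simp split: option.split prod.split, auto simp: add_less_iff)
qed

text \<open>\<^const>\<open>monomial_magn\<close> identifies the exponents with the archimedean classes of monomials.\<close>

lemma monomial_magn_mono: "x \<le> y \<Longrightarrow> monomial_magn x \<le> monomial_magn y"
  unfolding less_eq_monomial_def by transfer (auto split: option.splits prod.splits)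

lemma monomial_magn_nmult: "monomial_magn (nmult n x) \<le> monomial_magn x"
proof (induction n)
  case 0
  show ?case by (simp, transfer) simp
next
  case (Suc n)
  have "monomial_magn (y + x) \<le> monomial_magn x"
    if "monomial_magn y \<le> monomial_magn x" for y
    using that by transfer (auto split: option.splits prod.splits if_splits)
  with Suc show ?case by (simp add: nmult_Suc)
qed

lemma Rep_monomial_nmult:
  "Rep_monomial x = Some (r, e) \<Longrightarrow> Rep_monomial (nmult (Suc n) x) = Some (real (Suc n) * r, e)"
  by (induction n) (simp_all add: nmult_Suc[of "Suc _"] plus_monomial.rep_eq algebra_simps)

lemma arch_equiv_monomial_iff: "arch_equiv x y \<longleftrightarrow> monomial_magn x = monomial_magn y"
proof
  assume "arch_equiv x y"
  then show "monomial_magn x = monomial_magn y"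
    unfolding arch_equiv_iff
    by (meson antisym monomial_magn_mono monomial_magn_nmult order_trans)
next
  have *: "\<exists>n. x \<le> nmult n y" if eq: "monomial_magn x = monomial_magn y" for x y :: "'a monomial"
  proof (cases "Rep_monomial x")
    case None
    then have "x = 0" by (metis Rep_monomial_inject zero_monomial.rep_eq)
    then show ?thesis using zero_least by blast
  next
    case (Some p)
    then obtain r e where x: "Rep_monomial x = Some (r, e)" "e \<noteq> bot"
      using Rep_monomial[of x] by (cases p) auto
    then obtain s where y: "Rep_monomial y = Some (s, e)" "0 < s"
      using eq Rep_monomial[of y]
      by (auto simp: monomial_magn.rep_eq split: option.splits prod.splits)
    obtain n where "r < real n * s" using ex_less_of_nat_mult[OF y(2)] by blast
    also have "\<dots> \<le> real (Suc n) * s" using y(2) by simp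
    finally have "x < nmult (Suc n) y"
      by (simp add: less_monomial.rep_eq x Rep_monomial_nmult[OF y(1)])
    then show ?thesis by (blast intro: less_imp_le)
  qed
  show "monomial_magn x = monomial_magn y \<Longrightarrow> arch_equiv x y"
    unfolding arch_equiv_iff using *[of x y] *[of y x] by simp
qed

section \<open>Homomorphisms\<close>

definition semiring_hom :: "('a::semiring_1 \<Rightarrow> 'b::semiring_1) \<Rightarrow> bool"
  where "semiring_hom f \<longleftrightarrow> f 0 = 0 \<and> f 1 = 1 \<and>
    (\<forall>x y. f (x + y) = f x + f y) \<and> (\<forall>x y. f (x * y) = f x * f y)"

end

theory Submission
  imports Defs
begin

text \<open>
  A homomorphism over \<open>D\<close> must send \<open>x \<noteq> 0\<close> to \<open>c x Z\<^sup>e\<close> with \<open>e = magn x\<close> and a positive real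
  coefficient \<open>c x\<close>; the problem is to choose the coefficients multiplicatively while matching
  addition and \<^const>\<open>nearly_equal\<close>.

  Inside one archimedean class the order dictates the choice: as in Hoelder's theorem, \<open>x\<close> and \<open>y\<close>
  of the same magnitude have a real ratio, the infimum of the \<open>m / n\<close> with
  \<open>nmult n x \<le> nmult m y\<close>, and \<open>c x / c y\<close> is taken to be this ratio. For fixed \<open>y\<close> the ratio is
  additive and monotone in \<open>x\<close>, and up to a real factor it is the only such function
  (\<open>additive_mono_eq_ratio\<close>). Uniqueness gives \<open>ratio (x * z) (y * z) = ratio x y\<close> and the
  cocycle rule, so the ratio is a homomorphism on the group \<open>H\<close> of fractions \<open>x / y\<close> with \<open>x\<close>
  and \<open>y\<close> of equal magnitude. It also vanishes when \<open>x\<close> is of smaller magnitude than \<open>y\<close>,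
  which is why the smaller summand disappears in the monomial semiring. Finally, the ratio is
  \<open>1\<close> exactly when \<open>x\<close> and \<open>y\<close> are nearly equal (\<open>nearly_equal_iff\<close>).

  Between different classes the coefficients are constrained by multiplication alone. The
  logarithm of the ratio is a homomorphism from \<open>H\<close>, a subgroup of the group of fractions of
  the nonzero elements, to the divisible group of reals, so by Zorn's lemma it extends to the
  whole group (\<open>difference_data_hom\<close>). The exponential of such an extension is \<open>c\<close>.
\<close>

section \<open>The ratio of two elements of comparable magnitude\<close>

definition ratio :: "'a::measuring_semiring \<Rightarrow> 'a \<Rightarrow> real"
  where "ratio x y = Inf {real m / real n | m n. 0 < n \<and> nmult n x \<le> nmult m y}"

lemma nmult_le_cancel:
  fixes y :: "'a::measuring_semiring"
  assumes "0 < y"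
  shows "nmult m y \<le> nmult n y \<longleftrightarrow> m \<le> n"
proof -
  have "strict_mono (\<lambda>n. nmult n y)"
    unfolding strict_mono_Suc_iff using nmult_less_Suc[OF assms] by blast
  then show ?thesis by (rule strict_mono_less_eq)
qed

lemma nmult_add: "nmult n (x + y) = nmult n x + nmult n y"
  by (simp add: nmult_of_nat distrib_left)

lemma nmult_add_left: "nmult (m + n) x = nmult m x + nmult n x"
  by (simp add: nmult_of_nat distrib_right)

lemma ratio_upper:
  assumes "0 < y" "nmult n x \<le> nmult m y"
  shows "real n * ratio x y \<le> real m"
proof (cases "n = 0")
  case False
  have "bdd_below {real m / real n | m n. 0 < n \<and> nmult n x \<le> nmult m y}"
    by (rule bdd_belowI[of _ 0]) auto
  then have "ratio x y \<le> real m / real n"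
    unfolding ratio_def using False assms(2) by (intro cInf_lower) auto
  then show ?thesis using False by (simp add: field_simps)
qed simp

text \<open>
  Every fraction \<open>m / n\<close> below \<open>x : y\<close> is a lower bound of all fractions \<open>m' / n'\<close> above it: comparing
  \<open>n n' x\<close> with multiples of \<open>y\<close> gives \<open>m n' \<le> n m'\<close>, because distinct multiples of \<open>y\<close> are
  strictly ordered. The hypothesis \<open>arch_le x y\<close> makes the set of upper fractions nonempty.
\<close>

lemma ratio_lower:
  assumes "0 < y" "arch_le x y" "nmult m y \<le> nmult n x"
  shows "real m \<le> real n * ratio x y"
proof (cases "n = 0")
  case True
  then have "nmult m y \<le> nmult 0 y" using assms(3) by simp
  then have "m = 0" unfolding nmult_le_cancel[OF assms(1)] by simp
  then show ?thesis using True by simp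
next
  case False
  have "real m / real n \<le> ratio x y"
    unfolding ratio_def
  proof (rule cInf_greatest)
    obtain k where "x \<le> nmult k y" using assms(2) unfolding arch_le_iff by blast
    then have "nmult (Suc 0) x \<le> nmult k y" by simp
    then show "{real m / real n | m n. 0 < n \<and> nmult n x \<le> nmult m y} \<noteq> {}" by blast
  next
    fix q assume "q \<in> {real m / real n | m n. 0 < n \<and> nmult n x \<le> nmult m y}"
    then obtain m' n' where q: "q = real m' / real n'" "0 < n'" "nmult n' x \<le> nmult m' y"
      by blast
    have "nmult (n' * m) y \<le> nmult (n' * n) x"
      using nmult_mono[OF assms(3), of n'] by (simp only: nmult_nmult)
    also have "\<dots> = nmult (n * n') x" by (simp add: mult.commute)
    also have "\<dots> \<le> nmult (n * m') y"
      using nmult_mono[OF q(3), of n] by (simp only: nmult_nmult)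
    finally have "n' * m \<le> n * m'" unfolding nmult_le_cancel[OF assms(1)] .
    then have "real n' * real m \<le> real n * real m'"
      by (metis of_nat_le_iff of_nat_mult)
    then show "real m / real n \<le> q"
      unfolding q(1) using q(2) False by (simp add: field_simps)
  qed
  then show ?thesis using False by (simp add: field_simps)
qed

text \<open>
  Approximation with a fixed denominator: together with \<open>ratio_lower\<close> and \<open>ratio_upper\<close>
  it locates \<open>n * ratio x y\<close> between \<open>m\<close> and \<open>m + 1\<close>. Identities between ratios follow by
  bounding \<open>n\<close> times their error independently of \<open>n\<close>.
\<close>

lemma nmult_floor:
  assumes "0 < y" "arch_le x y"
  obtains m where "nmult m y \<le> nmult n x" "nmult n x \<le> nmult (Suc m) y"
proof -
  obtain k where "x \<le> nmult k y" using assms(2) unfolding arch_le_iff by blast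
  then have ex: "nmult n x \<le> nmult (n * k) y" by (metis nmult_mono nmult_nmult)
  define k0 where "k0 = (LEAST k. nmult n x \<le> nmult k y)"
  have le: "nmult n x \<le> nmult k0 y" unfolding k0_def using ex by (rule LeastI)
  show ?thesis
  proof (cases k0)
    case 0
    then have "nmult n x = 0" using le zero_least[of "nmult n x"] by simp
    then show ?thesis using that[of 0] zero_least[of y] by simp
  next
    case (Suc m)
    then have "\<not> nmult n x \<le> nmult m y"
      using not_less_Least[of m "\<lambda>k. nmult n x \<le> nmult k y"] unfolding k0_def by simp
    then show ?thesis using le Suc that[of m] by simp
  qed
qed

lemma arch_le_add:
  assumes "arch_le x z" "arch_le y z"
  shows "arch_le (x + y) z"
  using assms unfolding arch_le_iff by (metis add_mono nmult_add_left)

lemma arch_le_nmult: "arch_le x z \<Longrightarrow> arch_le (nmult n x) z"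
  unfolding arch_le_iff by (metis nmult_le_trans order_refl)

lemma arch_le_mult_right: "arch_le x y \<Longrightarrow> arch_le (x * z) (y * z)"
  unfolding arch_le_iff by (metis mult_mono_right nmult_mult)

lemma arch_le_refl: "arch_le x x"
  by (simp add: arch_le_def)

lemma ratio_add:
  assumes "0 < y" "arch_le x y" "arch_le x' y"
  shows "ratio (x + x') y = ratio x y + ratio x' y"
proof -
  let ?d = "ratio (x + x') y - (ratio x y + ratio x' y)"
  have "real n * \<bar>?d\<bar> \<le> 2" for n
  proof -
    obtain m where m: "nmult m y \<le> nmult n x" "nmult n x \<le> nmult (Suc m) y"
      using nmult_floor[OF assms(1,2)] by blast
    obtain m' where m': "nmult m' y \<le> nmult n x'" "nmult n x' \<le> nmult (Suc m') y"
      using nmult_floor[OF assms(1,3)] by blast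
    have "nmult (m + m') y \<le> nmult n (x + x')"
      unfolding nmult_add nmult_add_left using m(1) m'(1) by (rule add_mono)
    then have 1: "real (m + m') \<le> real n * ratio (x + x') y"
      by (rule ratio_lower[OF assms(1) arch_le_add[OF assms(2,3)]])
    have "nmult n (x + x') \<le> nmult (Suc m + Suc m') y"
      unfolding nmult_add nmult_add_left using m(2) m'(2) by (rule add_mono)
    then have 2: "real n * ratio (x + x') y \<le> real (Suc m + Suc m')"
      by (rule ratio_upper[OF assms(1)])
    note 3 = ratio_lower[OF assms(1,2) m(1)] ratio_lower[OF assms(1,3) m'(1)]
      ratio_upper[OF assms(1) m(2)] ratio_upper[OF assms(1) m'(2)]
    have "\<bar>real n * ?d\<bar> \<le> 2"
      using 1 2 3 by (simp add: algebra_simps abs_le_iff)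
    then show ?thesis by (simp add: abs_mult)
  qed
  then have "\<bar>?d\<bar> = 0" by (intro real_archimedian_rdiv_eq_0[of _ 2]) auto
  then show ?thesis by simp
qed

lemma ratio_self:
  assumes "0 < y"
  shows "ratio y y = 1"
  using ratio_upper[OF assms, of 1 y 1] ratio_lower[OF assms arch_le_refl, of 1 1] by simp

lemma ratio_mono:
  assumes "0 < y" "arch_le x' y" "x \<le> x'"
  shows "ratio x y \<le> ratio x' y"
proof -
  have "ratio x y - ratio x' y \<le> 0"
  proof (rule ccontr)
    assume "\<not> ?thesis"
    then obtain n where n: "1 < real n * (ratio x y - ratio x' y)"
      using ex_less_of_nat_mult[of "ratio x y - ratio x' y" 1] by auto
    obtain m where m: "nmult m y \<le> nmult n x'" "nmult n x' \<le> nmult (Suc m) y"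
      using nmult_floor[OF assms(1,2)] by blast
    have "nmult n x \<le> nmult (Suc m) y" using m(2) nmult_mono[OF assms(3)] order_trans by blast
    then have "real n * ratio x y \<le> real (Suc m)" by (rule ratio_upper[OF assms(1)])
    moreover have "real m \<le> real n * ratio x' y" by (rule ratio_lower[OF assms(1,2) m(1)])
    ultimately show False using n by (simp add: algebra_simps)
  qed
  then show ?thesis by simp
qed

text \<open>
  Applying \<open>f\<close> to \<open>m y \<le> n x \<le> (m + 1) y\<close> puts \<open>n f x\<close> in the interval from \<open>m f y\<close> to
  \<open>(m + 1) f y\<close>, which contains \<open>n f y ratio x y\<close> as well; let \<open>n\<close> grow.
  The multiplicative laws of the ratio are instances of this uniqueness principle.
\<close>

lemma additive_mono_eq_ratio:
  fixes f :: "'a::measuring_semiring \<Rightarrow> real"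
  assumes y: "0 < y"
    and add: "\<And>x x'. arch_le x y \<Longrightarrow> arch_le x' y \<Longrightarrow> f (x + x') = f x + f x'"
    and mono: "\<And>x x'. arch_le x' y \<Longrightarrow> x \<le> x' \<Longrightarrow> f x \<le> f x'"
    and x: "arch_le x y"
  shows "f x = f y * ratio x y"
proof -
  have "arch_le 0 y" by (simp add: arch_le_def zero_least)
  then have f0: "f 0 = 0" using add[of 0 0] by simp
  have f_nmult: "f (nmult n z) = real n * f z" if "arch_le z y" for n z
    by (induction n)
      (simp_all add: f0 nmult_Suc add[OF arch_le_nmult] that distrib_right)
  have fy: "0 \<le> f y" using mono[OF arch_le_refl zero_least] f0 by simp
  let ?d = "f x - f y * ratio x y"
  have "real n * \<bar>?d\<bar> \<le> f y" for n
  proof -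
    obtain m where m: "nmult m y \<le> nmult n x" "nmult n x \<le> nmult (Suc m) y"
      using nmult_floor[OF y x] by blast
    have "real m * f y \<le> real n * f x" "real n * f x \<le> real (Suc m) * f y"
      using mono[OF arch_le_nmult[OF x] m(1)] mono[OF arch_le_nmult[OF arch_le_refl] m(2)]
      by (simp_all only: f_nmult x arch_le_refl)
    moreover have "f y * real m \<le> f y * (real n * ratio x y)"
      using ratio_lower[OF y x m(1)] fy by (rule mult_left_mono)
    moreover have "f y * (real n * ratio x y) \<le> f y * real (Suc m)"
      using ratio_upper[OF y m(2)] fy by (rule mult_left_mono)
    ultimately have "\<bar>real n * ?d\<bar> \<le> f y" by (simp add: algebra_simps abs_le_iff)
    then show ?thesis by (simp add: abs_mult)
  qed
  then have "\<bar>?d\<bar> = 0" using fy by (intro real_archimedian_rdiv_eq_0[of _ "f y"]) auto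
  then show ?thesis by simp
qed

text \<open>
  As a function of \<open>x\<close> the left-hand side is additive, monotone, and \<open>1\<close> at \<open>y\<close>.
\<close>

lemma ratio_mult_right:
  assumes "0 < y" "0 < z" "arch_le x y"
  shows "ratio (x * z) (y * z) = ratio x y"
proof -
  have yz: "0 < y * z" using assms(1,2) by (rule pos_mult_pos)
  have "ratio (x * z) (y * z) = ratio (y * z) (y * z) * ratio x y"
    by (rule additive_mono_eq_ratio[of y "\<lambda>x. ratio (x * z) (y * z)", OF assms(1) _ _ assms(3)])
      (simp_all add: distrib_right ratio_add ratio_mono yz arch_le_mult_right mult_mono_right)
  then show ?thesis using ratio_self[OF yz] by simp
qed

text \<open>
  As a function of \<open>x\<close> the left-hand side is additive and monotone, with value \<open>ratio y z\<close> at \<open>y\<close>.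
\<close>

lemma ratio_trans:
  assumes "0 < y" "0 < z" "arch_le y z" "arch_le x y"
  shows "ratio x z = ratio y z * ratio x y"
proof -
  have le: "arch_le u z" if "arch_le u y" for u
    using that assms(3) unfolding arch_le_iff by (meson nmult_le_trans)
  show ?thesis
    by (rule additive_mono_eq_ratio[of y "\<lambda>x. ratio x z", OF assms(1) _ _ assms(4)])
      (simp_all add: le ratio_add ratio_mono assms(2))
qed

lemma arch_equiv_imp_arch_le: "arch_equiv x y \<Longrightarrow> arch_le x y"
  by (simp add: arch_le_def)

lemma ratio_mult:
  assumes "0 < x" "0 < y" "0 < x'" "0 < y'" "arch_equiv x y" "arch_equiv x' y'"
  shows "ratio (x * x') (y * y') = ratio x y * ratio x' y'"
proof -
  have le: "arch_le x y" "arch_le x' y'"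
    using assms(5,6) by (simp_all add: arch_equiv_imp_arch_le)
  have "ratio (x * x') (y * y') = ratio (y * x') (y * y') * ratio (x * x') (y * x')"
  proof (rule ratio_trans)
    show "arch_le (y * x') (y * y')"
      using arch_le_mult_right[OF le(2), of y] by (simp add: mult.commute)
    show "arch_le (x * x') (y * x')" by (rule arch_le_mult_right[OF le(1)])
  qed (use assms in \<open>simp_all add: pos_mult_pos\<close>)
  moreover have "ratio (y * x') (y * y') = ratio x' y'"
    using ratio_mult_right[OF assms(4,2) le(2)] by (simp add: mult.commute)
  ultimately show ?thesis using ratio_mult_right[OF assms(2,3) le(1)] by simp
qed

lemma ratio_inverse:
  assumes "0 < x" "0 < y" "arch_equiv x y"
  shows "ratio x y * ratio y x = 1"
  using ratio_trans[of x y y] assms ratio_self[of y]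
  by (simp add: arch_equiv_imp_arch_le arch_equiv_sym)

lemma ratio_nonneg:
  assumes "0 < y" "arch_le x y"
  shows "0 \<le> ratio x y"
  using ratio_lower[OF assms, of 0 1] zero_least[of x] by simp

lemma ratio_pos:
  assumes "0 < x" "0 < y" "arch_equiv x y"
  shows "0 < ratio x y"
  using ratio_inverse[OF assms] ratio_nonneg[OF assms(2) arch_equiv_imp_arch_le[OF assms(3)]]
  by (cases "ratio x y = 0") auto

text \<open>
  All multiples of \<open>x\<close> stay below \<open>y\<close>, so \<open>n * ratio x y \<le> 1\<close> for every \<open>n\<close>.
\<close>

lemma ratio_smaller_magnitude:
  assumes "0 < y" "\<not> arch_le y x"
  shows "ratio x y = 0"
proof -
  have lt: "nmult n x \<le> nmult 1 y" for n
    using assms(2) unfolding arch_le_iff by (simp add: less_imp_le not_le)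
  have "arch_le x y" using assms(2) unfolding arch_le_def by (meson linear)
  then show ?thesis
    using ratio_upper[OF assms(1) lt]
    by (intro real_archimedian_rdiv_eq_0[of _ 1] ratio_nonneg assms(1)) auto
qed

lemma le_qmult_iff:
  assumes "0 < m" "0 < n"
  shows "x \<le> qmult (of_nat m / of_nat n) y \<longleftrightarrow> nmult n x \<le> nmult m y"
proof -
  let ?t = "qmult (of_nat m / of_nat n) y"
  have t: "nmult n ?t = nmult m y" using qmult_iff[OF assms, of y ?t] by simp
  show ?thesis
    using nmult_mono[of x ?t n] nmult_strict_mono[OF _ assms(2), of ?t x]
    unfolding t by (meson not_le)
qed

lemma rat_greater_1_cases:
  assumes "(1::rat) < q"
  obtains m n where "q = of_nat m / of_nat n" "0 < n" "n < m"
proof -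
  obtain a b where ab: "q = of_int a / of_int b" "0 < b"
    using quotient_of_div[of q] quotient_of_denom_pos[of q] by (metis surj_pair)
  have "b < a" using assms ab by (simp add: field_simps)
  then show ?thesis using ab by (intro that[of "nat a" "nat b"]) auto
qed

text \<open>
  The rationals \<open>q = (n + 1) / n\<close> alone force the ratio to be \<open>1\<close>: they give
  \<open>n ratio x y \<le> n + 1\<close> and \<open>n \<le> (n + 1) ratio x y\<close>. Conversely, if \<open>x \<le> q y\<close> failed
  for \<open>q = m / n > 1\<close>, then \<open>m y \<le> n x\<close> would make the ratio at least \<open>m / n\<close>.
\<close>

lemma nearly_equal_iff:
  fixes x y :: "'a::divisible_measuring_semiring"
  assumes "0 < x" "0 < y"
  shows "nearly_equal x y \<longleftrightarrow> arch_equiv x y \<and> ratio x y = 1"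
proof (cases "arch_equiv x y")
  case True
  have le: "arch_le x y" using True by (simp add: arch_le_def)
  have "ratio x y = 1" if near: "nearly_equal x y"
  proof -
    have 1: "nmult n x \<le> nmult (Suc n) y" "nmult n y \<le> nmult (Suc n) x" if "0 < n" for n
    proof -
      have "(1::rat) < of_nat (Suc n) / of_nat n" using that by (simp add: field_simps)
      then show "nmult n x \<le> nmult (Suc n) y" "nmult n y \<le> nmult (Suc n) x"
        using near that unfolding nearly_equal_def
        by (meson le_qmult_iff zero_less_Suc)+
    qed
    have "real n * \<bar>ratio x y - 1\<bar> \<le> ratio x y + 1" if "0 < n" for n
    proof -
      have "\<bar>real n * (ratio x y - 1)\<bar> \<le> ratio x y + 1"
        using ratio_upper[OF assms(2) 1(1)[OF that]] ratio_lower[OF assms(2) le 1(2)[OF that]]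
          ratio_nonneg[OF assms(2) le]
        by (simp add: algebra_simps abs_le_iff)
      then show ?thesis by (simp add: abs_mult)
    qed
    then have "\<bar>ratio x y - 1\<bar> = 0"
      using ratio_nonneg[OF assms(2) le]
      by (intro real_archimedian_rdiv_eq_0[of _ "ratio x y + 1"]) auto
    then show ?thesis by simp
  qed
  moreover have "nearly_equal x y" if r: "ratio x y = 1"
    unfolding nearly_equal_def
  proof (intro conjI allI impI True)
    fix q :: rat assume "1 < q"
    then obtain m n where q: "q = of_nat m / of_nat n" "0 < n" "n < m"
      by (rule rat_greater_1_cases)
    have "nmult n x \<le> nmult m y"
    proof (rule ccontr)
      assume "\<not> ?thesis"
      then have "nmult m y \<le> nmult n x" by simp
      then show False using ratio_lower[OF assms(2) le] r q(3) by force
    qed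
    moreover have "nmult n y \<le> nmult m x"
    proof (rule ccontr)
      assume "\<not> ?thesis"
      then have "nmult m x \<le> nmult n y" by simp
      then show False using ratio_upper[OF assms(2)] r q(3) by force
    qed
    ultimately show "x \<le> qmult q y" "y \<le> qmult q x"
      using q by (simp_all add: le_qmult_iff)
  qed
  ultimately show ?thesis using True by blast
qed (simp add: nearly_equal_def)

section \<open>Extending a homomorphism into the reals\<close>

text \<open>
  A triple \<open>(x, y, t)\<close> prescribes \<open>L x - L y = t\<close> for an additive \<open>L\<close>. The conditions say that
  \<open>x / y \<mapsto> t\<close> is a well-defined homomorphism on a subgroup of the group of fractions of \<open>M\<close>;
  the last one is well-definedness, since \<open>x / y\<close> is trivial in that group iff
  \<open>x * z = y * z\<close> for some \<open>z \<in> M\<close>. Working with triples avoids constructing the group.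
\<close>

definition difference_data ::
    "'a::comm_monoid_mult set \<Rightarrow> ('a \<times> 'a \<times> real) set \<Rightarrow> bool"
  where "difference_data M G \<longleftrightarrow>
    (\<forall>(x, y, t) \<in> G. x \<in> M \<and> y \<in> M) \<and>
    (1, 1, 0) \<in> G \<and>
    (\<forall>(x, y, t) \<in> G. (y, x, - t) \<in> G) \<and>
    (\<forall>(x, y, t) \<in> G. \<forall>(x', y', t') \<in> G. (x * x', y * y', t + t') \<in> G) \<and>
    (\<forall>(x, y, t) \<in> G. \<forall>z \<in> M. x * z = y * z \<longrightarrow> t = 0)"

lemma
  assumes "difference_data M G"
  shows difference_data_carrier: "(x, y, t) \<in> G \<Longrightarrow> x \<in> M \<and> y \<in> M"
    and difference_data_one: "(1, 1, 0) \<in> G"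
    and difference_data_swap: "(x, y, t) \<in> G \<Longrightarrow> (y, x, - t) \<in> G"
    and difference_data_mult:
      "(x, y, t) \<in> G \<Longrightarrow> (x', y', t') \<in> G \<Longrightarrow> (x * x', y * y', t + t') \<in> G"
    and difference_data_cancel: "(x, y, t) \<in> G \<Longrightarrow> z \<in> M \<Longrightarrow> x * z = y * z \<Longrightarrow> t = 0"
  using assms unfolding difference_data_def by blast+

lemma difference_data_power:
  assumes "difference_data M G" "(x, y, t) \<in> G"
  shows "(x ^ n, y ^ n, real n * t) \<in> G"
proof (induction n)
  case 0
  then show ?case using difference_data_one[OF assms(1)] by simp
next
  case (Suc n)
  then show ?case using difference_data_mult[OF assms(1,2) Suc] by (simp add: algebra_simps)
qed

lemma power_closed:
  fixes M :: "'a::comm_monoid_mult set"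
  assumes "1 \<in> M" "\<And>x y. x \<in> M \<Longrightarrow> y \<in> M \<Longrightarrow> x * y \<in> M" "a \<in> M"
  shows "a ^ n \<in> M"
  by (induction n) (use assms in auto)

text \<open>
  The possible values \<open>L a = c\<close>. In the group of fractions, the fractions \<open>x / y\<close> of the
  subgroup that are powers \<open>a\<^sup>j / a\<^sup>i\<close> prescribe multiples of \<open>c\<close>. One such prescription with
  \<open>i \<noteq> j\<close> determines \<open>c\<close> by a division in the reals and, any two nontrivial powers of \<open>a\<close> having
  a common power, implies all the others; if there is none, every \<open>c\<close> is consistent.
\<close>

lemma difference_data_consistent_value:
  fixes M :: "'a::comm_monoid_mult set"
  assumes G: "difference_data M G"
    and M: "1 \<in> M" "\<And>x y. x \<in> M \<Longrightarrow> y \<in> M \<Longrightarrow> x * y \<in> M"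
    and a: "a \<in> M"
  obtains c where "\<And>x y t i j z. (x, y, t) \<in> G \<Longrightarrow> z \<in> M \<Longrightarrow>
    x * a ^ i * z = y * a ^ j * z \<Longrightarrow> t + (real i - real j) * c = 0"
proof (cases "\<exists>x y t i j z. (x, y, t) \<in> G \<and> z \<in> M \<and> x * a ^ i * z = y * a ^ j * z \<and> i \<noteq> j")
  case True
  then obtain x0 y0 t0 i0 j0 z0 where
    0: "(x0, y0, t0) \<in> G" "z0 \<in> M" "x0 * a ^ i0 * z0 = y0 * a ^ j0 * z0" "i0 \<noteq> j0"
    by blast
  show ?thesis
  proof (rule that[of "- t0 / (real i0 - real j0)"])
    fix x y t i j z
    assume 1: "(x, y, t) \<in> G" "z \<in> M" "x * a ^ i * z = y * a ^ j * z"
    \<comment> \<open>Raise the equation for \<open>(x, y, t)\<close> to the power \<open>i0 - j0\<close> and the one for \<open>(x0, y0, t0)\<close>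
      to the power \<open>j - i\<close>, negative exponents being realised by exchanging the two sides.
      Then the powers of \<open>a\<close> on both sides of the product agree and can be moved into \<open>?w\<close>.\<close>
    let ?X = "(x ^ i0 * y ^ j0) * (x0 ^ j * y0 ^ i)"
    let ?Y = "(y ^ i0 * x ^ j0) * (y0 ^ j * x0 ^ i)"
    let ?w = "a ^ (i * i0 + j * j0 + i0 * j + j0 * i) * (z ^ (i0 + j0) * z0 ^ (i + j))"
    note pow = difference_data_power[OF G]
    have "(?X, ?Y, (real i0 * t + real j0 * - t) + (real j * t0 + real i * - t0)) \<in> G"
      by (intro difference_data_mult[OF G] pow 0(1) 1(1) difference_data_swap[OF G])
    moreover have "?w \<in> M"
      by (intro M(2) power_closed[OF M] a 0(2) 1(2))
    moreover have "?X * ?w = ?Y * ?w"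
    proof -
      have "?X * ?w = (x * a ^ i * z) ^ i0 * (y * a ^ j * z) ^ j0
          * ((x0 * a ^ i0 * z0) ^ j * (y0 * a ^ j0 * z0) ^ i)"
        by (simp add: power_mult_distrib power_add power_mult[symmetric] ac_simps)
      also have "\<dots> = (y * a ^ j * z) ^ i0 * (x * a ^ i * z) ^ j0
          * ((y0 * a ^ j0 * z0) ^ j * (x0 * a ^ i0 * z0) ^ i)"
        by (simp only: 0(3) 1(3))
      also have "\<dots> = ?Y * ?w"
        by (simp add: power_mult_distrib power_add power_mult[symmetric] ac_simps)
      finally show ?thesis .
    qed
    ultimately have "(real i0 * t + real j0 * - t) + (real j * t0 + real i * - t0) = 0"
      by (rule difference_data_cancel[OF G])
    then show "t + (real i - real j) * (- t0 / (real i0 - real j0)) = 0"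
      using 0(4) by (simp add: field_simps)
  qed
next
  case False
  show ?thesis
  proof (rule that[of 0])
    fix x y t i j z
    assume 1: "(x, y, t) \<in> G" "z \<in> M" "x * a ^ i * z = y * a ^ j * z"
    then have "i = j" using False by blast
    then have "x * (a ^ i * z) = y * (a ^ i * z)" using 1(3) by (simp add: mult.assoc)
    then have "t = 0"
      using difference_data_cancel[OF G 1(1)] M(2) power_closed[OF M a] 1(2) by blast
    then show "t + (real i - real j) * 0 = 0" by simp
  qed
qed

text \<open>
  The extension is to the subgroup generated by \<open>a\<close>; negative powers of \<open>a\<close> appear in the
  denominators.
\<close>

lemma difference_data_extend:
  fixes M :: "'a::comm_monoid_mult set"
  assumes G: "difference_data M G"
    and M: "1 \<in> M" "\<And>x y. x \<in> M \<Longrightarrow> y \<in> M \<Longrightarrow> x * y \<in> M"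
    and a: "a \<in> M"
  obtains G' c where "difference_data M G'" "G \<subseteq> G'" "(a, 1, c) \<in> G'"
proof -
  obtain c where c: "\<And>x y t i j z. (x, y, t) \<in> G \<Longrightarrow> z \<in> M \<Longrightarrow>
      x * a ^ i * z = y * a ^ j * z \<Longrightarrow> t + (real i - real j) * c = 0"
    using difference_data_consistent_value[OF assms] by blast
  define G' where "G' = {(x * a ^ i, y * a ^ j, t + (real i - real j) * c) | x y t i j.
    (x, y, t) \<in> G}"
  have G'I: "(u, v, s) \<in> G'"
    if "(x, y, t) \<in> G" "u = x * a ^ i" "v = y * a ^ j" "s = t + (real i - real j) * c"
    for u v s x y t i j
    using that unfolding G'_def by blast
  have G'E: "\<exists>x y t i j. (x, y, t) \<in> G \<and> u = x * a ^ i \<and> v = y * a ^ j \<and>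
      s = t + (real i - real j) * c" if "(u, v, s) \<in> G'" for u v s
    using that unfolding G'_def by blast
  have carrier: "u \<in> M \<and> v \<in> M" if "(u, v, s) \<in> G'" for u v s
    using G'E[OF that] difference_data_carrier[OF G] M(2) power_closed[OF M a] by blast
  have one: "(1, 1, 0) \<in> G'"
    by (rule G'I[OF difference_data_one[OF G], of _ 0 _ 0]) simp_all
  have swap: "(v, u, - s) \<in> G'" if uvs: "(u, v, s) \<in> G'" for u v s
  proof -
    obtain x y t i j where "(x, y, t) \<in> G" "u = x * a ^ i" "v = y * a ^ j"
        "s = t + (real i - real j) * c"
      using G'E[OF uvs] by blast
    then show ?thesis
      by (intro G'I[OF difference_data_swap[OF G], of x y t _ j _ i]) (simp_all add: algebra_simps)
  qed
  have mult: "(u * u', v * v', s + s') \<in> G'"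
    if uvs: "(u, v, s) \<in> G'" "(u', v', s') \<in> G'" for u v s u' v' s'
  proof -
    obtain x y t i j where 1: "(x, y, t) \<in> G" "u = x * a ^ i" "v = y * a ^ j"
        "s = t + (real i - real j) * c"
      using G'E[OF uvs(1)] by blast
    obtain x' y' t' i' j' where 2: "(x', y', t') \<in> G" "u' = x' * a ^ i'" "v' = y' * a ^ j'"
        "s' = t' + (real i' - real j') * c"
      using G'E[OF uvs(2)] by blast
    show ?thesis
      by (rule G'I[OF difference_data_mult[OF G 1(1) 2(1)], of _ "i + i'" _ "j + j'"])
        (simp_all add: 1 2 power_add ac_simps, simp add: algebra_simps)
  qed
  have cancel: "s = 0" if "(u, v, s) \<in> G'" "z \<in> M" "u * z = v * z" for u v s z
    using G'E[OF that(1)] c that(2,3) by blast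
  have "difference_data M G'"
    unfolding difference_data_def using carrier one swap mult cancel by blast
  moreover have "G \<subseteq> G'"
  proof
    fix p assume "p \<in> G"
    moreover obtain x y t where "p = (x, y, t)" by (cases p)
    ultimately show "p \<in> G'" using G'I[of x y t x 0 y 0 t] by simp
  qed
  moreover have "(a, 1, c) \<in> G'"
    by (rule G'I[OF difference_data_one[OF G], of _ 1 _ 0]) simp_all
  ultimately show ?thesis by (rule that)
qed

lemma difference_data_chain_Union:
  assumes ne: "C \<noteq> {}" and C: "subset.chain {G. difference_data M G} C"
  shows "difference_data M (\<Union>C)"
proof -
  have data: "difference_data M G" if "G \<in> C" for G
    using that C unfolding subset.chain_def by blast
  have two: "\<exists>G\<in>C. p \<in> G \<and> q \<in> G" if "p \<in> \<Union>C" "q \<in> \<Union>C" for p q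
    using that C unfolding subset.chain_def by blast
  have "(x * x', y * y', t + t') \<in> \<Union>C"
    if "(x, y, t) \<in> \<Union>C" "(x', y', t') \<in> \<Union>C" for x y t x' y' t'
    using two[OF that] difference_data_mult[OF data] by blast
  moreover have "(1, 1, 0) \<in> \<Union>C" using ne difference_data_one[OF data] by blast
  moreover have "(y, x, - t) \<in> \<Union>C" if "(x, y, t) \<in> \<Union>C" for x y t
    using that difference_data_swap[OF data] by blast
  moreover have "x \<in> M \<and> y \<in> M" if "(x, y, t) \<in> \<Union>C" for x y t
    using that difference_data_carrier[OF data] by blast
  moreover have "t = 0" if "(x, y, t) \<in> \<Union>C" "z \<in> M" "x * z = y * z" for x y t z
    using that difference_data_cancel[OF data] by blast
  ultimately show ?thesis unfolding difference_data_def by blast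
qed

text \<open>
  Extension of homomorphisms into a divisible group. A maximal set of prescriptions determines
  \<open>L a\<close> for every \<open>a \<in> M\<close>, as otherwise \<open>difference_data_extend\<close> would enlarge it.
\<close>

lemma difference_data_hom:
  fixes M :: "'a::comm_monoid_mult set"
  assumes G: "difference_data M G"
    and M: "1 \<in> M" "\<And>x y. x \<in> M \<Longrightarrow> y \<in> M \<Longrightarrow> x * y \<in> M"
  obtains L :: "'a \<Rightarrow> real"
  where "\<And>x y. x \<in> M \<Longrightarrow> y \<in> M \<Longrightarrow> L (x * y) = L x + L y"
    and "\<And>x y t. (x, y, t) \<in> G \<Longrightarrow> t = L x - L y"
proof -
  let ?A = "{H. difference_data M H \<and> G \<subseteq> H}"
  have "\<exists>H\<in>?A. \<forall>X\<in>?A. H \<subseteq> X \<longrightarrow> X = H"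
  proof (rule subset_Zorn_nonempty)
    show "?A \<noteq> {}" using G by blast
  next
    fix C assume C: "C \<noteq> {}" "subset.chain ?A C"
    then have "subset.chain {G. difference_data M G} C"
      unfolding subset.chain_def by blast
    moreover have "G \<subseteq> \<Union>C" using C unfolding subset.chain_def by blast
    ultimately show "\<Union>C \<in> ?A" using difference_data_chain_Union[OF C(1)] by blast
  qed
  then obtain H where HA: "H \<in> ?A" and maxA: "\<forall>X\<in>?A. H \<subseteq> X \<longrightarrow> X = H" by (rule bexE)
  then have H: "difference_data M H" "G \<subseteq> H" by simp_all
  have max: "X = H" if "difference_data M X" "H \<subseteq> X" for X
    using maxA that H(2) by (simp add: order_trans[of G H X])
  have "\<exists>c. (a, 1, c) \<in> H" if "a \<in> M" for a
  proof -
    obtain X c where "difference_data M X" "H \<subseteq> X" "(a, 1, c) \<in> X"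
      using difference_data_extend[OF H(1) M \<open>a \<in> M\<close>] by blast
    then show ?thesis using max by blast
  qed
  then obtain L where L: "\<And>a. a \<in> M \<Longrightarrow> (a, 1, L a) \<in> H" by metis
  have diff: "t = L x - L y" if "(x, y, t) \<in> H" for x y t
  proof -
    have xy: "x \<in> M" "y \<in> M" using difference_data_carrier[OF H(1) that] by auto
    \<comment> \<open>The product of \<open>x / y\<close>, \<open>1 / x\<close> and \<open>y / 1\<close> is trivial.\<close>
    have "(x * (1 * y), y * (x * 1), t + (- L x + L y)) \<in> H"
      by (intro difference_data_mult[OF H(1)] that L xy difference_data_swap[OF H(1)])
    then have "t + (- L x + L y) = 0"
      by (rule difference_data_cancel[OF H(1) _ M(1)]) (simp add: mult.commute)
    then show ?thesis by simp
  qed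
  have L1: "L 1 = 0" by (rule difference_data_cancel[OF H(1) L[OF M(1)] M(1)]) simp
  have "L (x * y) = L x + L y" if "x \<in> M" "y \<in> M" for x y
    using diff[OF difference_data_mult[OF H(1) L[OF that(1)] L[OF that(2)]]] L1 by simp
  then show ?thesis using that diff H(2) by blast
qed

section \<open>The homomorphism to the monomial semiring\<close>

text \<open>
  The logarithm of the ratio is consistent in the sense of \<^const>\<open>difference_data\<close>: if
  \<open>x * z = y * z\<close> with \<open>z > 0\<close>, then \<open>ratio x y = ratio (x * z) (y * z) = 1\<close>.
\<close>

lemma log_coefficient:
  obtains L :: "'a::measuring_semiring \<Rightarrow> real"
  where "\<And>x y. 0 < x \<Longrightarrow> 0 < y \<Longrightarrow> L (x * y) = L x + L y"
    and "\<And>x y. 0 < x \<Longrightarrow> 0 < y \<Longrightarrow> arch_equiv x y \<Longrightarrow> ratio x y = exp (L x - L y)"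
proof -
  let ?M = "{x :: 'a. 0 < x}"
  let ?G = "{(x, y, ln (ratio x y)) | x y :: 'a. 0 < x \<and> 0 < y \<and> arch_equiv x y}"
  have pos1: "(0::'a) < 1" using zero_least[of "1::'a"] by (simp add: less_le)
  have inv: "- ln (ratio x y) = ln (ratio y x)"
    if "0 < x" "0 < y" "arch_equiv x y" for x y :: 'a
  proof -
    have "ln (ratio x y * ratio y x) = 0" using ratio_inverse[OF that] by simp
    then show ?thesis
      using ratio_pos[of x y] ratio_pos[of y x] that by (simp add: ln_mult_pos arch_equiv_sym)
  qed
  have G: "difference_data ?M ?G"
    unfolding difference_data_def
  proof (intro conjI)
    show "(1, 1, 0) \<in> ?G"
    proof -
      have "0 = ln (ratio (1::'a) 1)" by (simp add: ratio_self[OF pos1])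
      then show ?thesis using pos1 arch_equiv_refl[of "1::'a"] by blast
    qed
    show "\<forall>(x, y, t)\<in>?G. (y, x, - t) \<in> ?G"
      using inv arch_equiv_sym by fastforce
    have "\<exists>u v. x * x' = u \<and> y * y' = v \<and> ln (ratio x y) + ln (ratio x' y') = ln (ratio u v)
        \<and> 0 < u \<and> 0 < v \<and> arch_equiv u v"
      if "0 < x" "0 < y" "arch_equiv x y" "0 < x'" "0 < y'" "arch_equiv x' y'" for x y x' y' :: 'a
      using that ratio_pos[of x y] ratio_pos[of x' y']
      by (simp add: ratio_mult pos_mult_pos arch_equiv_mult ln_mult_pos)
    then show "\<forall>(x, y, t)\<in>?G. \<forall>(x', y', t')\<in>?G. (x * x', y * y', t + t') \<in> ?G"
      by fastforce
    have "ratio x y = 1" if "0 < x" "0 < y" "arch_equiv x y" "0 < z" "x * z = y * z"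
      for x y z :: 'a
      using ratio_mult_right[of y z x] that ratio_self[of "y * z"]
      by (simp add: pos_mult_pos arch_equiv_imp_arch_le)
    then show "\<forall>(x, y, t)\<in>?G. \<forall>z\<in>?M. x * z = y * z \<longrightarrow> t = 0" by auto
  qed auto
  obtain L where L: "\<And>x y. x \<in> ?M \<Longrightarrow> y \<in> ?M \<Longrightarrow> L (x * y) = L x + L y"
    "\<And>x y t. (x, y, t) \<in> ?G \<Longrightarrow> t = L x - L y"
    using difference_data_hom[OF G] pos1 pos_mult_pos by (metis (no_types, lifting) mem_Collect_eq)
  have "ratio x y = exp (L x - L y)" if "0 < x" "0 < y" "arch_equiv x y" for x y
  proof -
    have "ln (ratio x y) = L x - L y" using that by (intro L(2)) blast
    then show ?thesis using ratio_pos[OF that] by (metis exp_ln)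
  qed
  moreover have "L (x * y) = L x + L y" if "0 < x" "0 < y" for x y
    using that by (intro L(1)) simp_all
  ultimately show ?thesis by (rule that[rotated])
qed

lemma magn_eq_bot_iff: "magn x = bot \<longleftrightarrow> x = 0"
  by (metis arch_equiv_0_iff bot_magnitude.abs_eq magn_eq_iff)

lemma magn_add: "magn (x + y) = max (magn x) (magn y)"
proof -
  have 1: "magn (x + y) = magn y" if "magn x \<le> magn y" for x y :: 'a
  proof (rule antisym)
    show "magn (x + y) \<le> magn y"
      using that arch_le_add[OF _ arch_le_refl] by (simp add: less_eq_magnitude.abs_eq)
    show "magn y \<le> magn (x + y)"
      using le_add_right[of y x] by (simp add: less_eq_magnitude.abs_eq arch_le_def add.commute)
  qed
  show ?thesis using 1[of x y] 1[of y x] by 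
    (cases "magn x \<le> magn y") (auto simp: max_def add.commute)
qed

theorem theorem5p1p14:
  shows "\<exists>\<phi> :: 'a::divisible_measuring_semiring \<Rightarrow> 'a magnitude monomial.
    semiring_hom \<phi> \<and> magn = monomial_magn \<circ> \<phi> \<and>
    (\<forall>x y. nearly_equal x y \<longleftrightarrow> \<phi> x = \<phi> y)"
proof -
  obtain L :: "'a \<Rightarrow> real"
    where L_mult: "\<And>x y. 0 < x \<Longrightarrow> 0 < y \<Longrightarrow> L (x * y) = L x + L y"
      and L_ratio: "\<And>x y. 0 < x \<Longrightarrow> 0 < y \<Longrightarrow> arch_equiv x y \<Longrightarrow> ratio x y = exp (L x - L y)"
    using log_coefficient by blast
  define \<phi> :: "'a \<Rightarrow> 'a magnitude monomial"
    where "\<phi> x = Abs_monomial (if x = 0 then None else Some (exp (L x), magn x))" for x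
  have Rep: "Rep_monomial (\<phi> x) = (if x = 0 then None else Some (exp (L x), magn x))" for x
    unfolding \<phi>_def by (rule Abs_monomial_inverse) (simp add: magn_eq_bot_iff)
  have pos: "0 < x \<longleftrightarrow> x \<noteq> 0" for x :: 'a
    using zero_least[of x] by (auto simp: less_le)
  have pos1: "(0::'a) < 1" by (simp add: pos)
  have L1: "L 1 = 0" using L_mult[OF pos1 pos1] by simp
  \<comment> \<open>One formula covers equal and different magnitudes: \<open>ratio y x\<close> is \<open>exp (L y - L x)\<close> in the
    former case and \<open>0\<close> in the latter.\<close>
  have exp_L_add: "exp (L (x + y)) = exp (L x) * (1 + ratio y x)"
    if "0 < x" "magn y \<le> magn x" for x y
  proof -
    have "arch_le y x" using that(2) by (simp add: less_eq_magnitude.abs_eq)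
    then have "ratio (x + y) x = 1 + ratio y x"
      using ratio_add[OF that(1) arch_le_refl] ratio_self[OF that(1)] by simp
    moreover have "arch_equiv (x + y) x"
      using that(2) by (simp add: magn_eq_iff[symmetric] magn_add max_def)
    moreover have "0 < x + y" using that(1) le_add_right[of x y] by (rule less_le_trans)
    ultimately have "exp (L (x + y) - L x) = 1 + ratio y x" using L_ratio that(1) by metis
    then show ?thesis by (simp add: exp_diff field_simps)
  qed
  have exp_L_add_less: "exp (L (x + y)) = exp (L x)" if "0 < x" "magn y < magn x" for x y
    using exp_L_add[OF that(1) less_imp_le[OF that(2)]] that ratio_smaller_magnitude[of x y]
    by (simp add: less_eq_magnitude.abs_eq not_le[symmetric])
  have exp_L_add_eq: "exp (L (x + y)) = exp (L x) + exp (L y)"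
    if "0 < x" "0 < y" "magn y = magn x" for x y
    using exp_L_add[of x y] that L_ratio[of y x] by (simp add: magn_eq_iff exp_diff field_simps)
  have add_0: "x + y = 0 \<longleftrightarrow> x = 0 \<and> y = 0" for x y :: 'a
    using magn_eq_bot_iff[of "x + y"] magn_eq_bot_iff[of x] magn_eq_bot_iff[of y]
    by (auto simp: magn_add max_def split: if_splits)
  have mult_0: "x * y = 0 \<longleftrightarrow> x = 0 \<or> y = 0" for x y :: 'a
    using pos_mult_pos[of x y] by (auto simp: pos)
  have "\<phi> 0 = 0" "\<phi> 1 = 1"
    by (simp_all add: Rep_monomial_inject[symmetric] Rep zero_monomial.rep_eq one_monomial.rep_eq
        L1 zero_magnitude.abs_eq)
  moreover have "\<phi> (x + y) = \<phi> x + \<phi> y" for x y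
  proof (cases "x = 0 \<or> y = 0")
    case True
    then show ?thesis using \<open>\<phi> 0 = 0\<close> by auto
  next
    case False
    consider "magn x = magn y" | "magn y < magn x" | "magn x < magn y" by force
    then show ?thesis
      using False exp_L_add_eq[of x y] exp_L_add_less[of x y] exp_L_add_less[of y x]
      by cases (auto simp: Rep_monomial_inject[symmetric] Rep plus_monomial.rep_eq add_0
          magn_add pos add.commute)
  qed
  moreover have "\<phi> (x * y) = \<phi> x * \<phi> y" for x y
    using L_mult[of x y]
    by (auto simp: Rep_monomial_inject[symmetric] Rep times_monomial.rep_eq mult_0
        plus_magnitude.abs_eq pos exp_add)
  ultimately have "semiring_hom \<phi>" unfolding semiring_hom_def by blast
  moreover have "magn = monomial_magn \<circ> \<phi>"
    by (auto simp: fun_eq_iff monomial_magn.rep_eq Rep magn_eq_bot_iff)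
  moreover have "nearly_equal x y \<longleftrightarrow> \<phi> x = \<phi> y" for x y
  proof (cases "0 < x \<and> 0 < y")
    case True
    then show ?thesis
      using L_ratio[of x y] nearly_equal_iff[of x y]
      by (auto simp: Rep_monomial_inject[symmetric] Rep pos magn_eq_iff)
  next
    case False
    have "nearly_equal 0 (0::'a)"
      by (simp add: nearly_equal_def arch_equiv_refl zero_least)
    then show ?thesis
      using False arch_equiv_0_iff[of x] arch_equiv_0_iff[of y] arch_equiv_sym[of x y]
      by (auto simp: Rep_monomial_inject[symmetric] Rep pos nearly_equal_def)
  qed
  ultimately show ?thesis by blast
qed

end
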